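(* Let $g, h:\mathbb{R}\to\mathbb{R}$ be tropical monotone rational functions with $p$ and $q$ tropical roots, respectively. Then the tropical monotone rational function $g\circ h$ has at most $p+q$ tropical roots. Moreover, if on an interval $[a,b]\subset\mathbb{R}$ the function $h$ is linear with slope $s$, and $g$ is linear with slope $l$ on the interval $[h(a),h(b)]$ (if $h$ is increasing), respectively on the interval $[h(b),h(a)]$ (if $h$ is decreasing), then $g\circ h$ is linear on $[a,b]$ with slope $sl$.
   Context: A tropical rational function (in one variable) is a continuous piecewise linear function $\mathbb{R}\to\mathbb{R}$ with finitely many linear pieces, all of whose slopes are integers. "Linear" means affine ($x\mapsto sx+r$). A tropical root of such a function is a point at which it is not differentiable. A tropical rational function is called monotone increasing (respectively, monotone decreasing) if all slopes of its linear pieces are positive (respectively, negative); it is monotone if it is monotone increasing or monotone decreasing. *)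

theory Defs
  imports "HOL-Analysis.Analysis"
begin

definition linear_with_slope :: "(real \<Rightarrow> real) \<Rightarrow> real set \<Rightarrow> real \<Rightarrow> bool" where
  "linear_with_slope f J s \<longleftrightarrow> (\<exists>r. \<forall>x\<in>J. f x = s * x + r)"

(* The non-empty interior makes the slope on J unique. Pieces are not required to be
   maximal: every piece has the slope of the maximal piece that contains it. *)
definition linear_piece :: "(real \<Rightarrow> real) \<Rightarrow> real set \<Rightarrow> real \<Rightarrow> bool" where
  "linear_piece f J s \<longleftrightarrow> is_interval J \<and> interior J \<noteq> {} \<and> linear_with_slope f J s"

definition tropical_rational :: "(real \<Rightarrow> real) \<Rightarrow> bool" where
  "tropical_rational f \<longleftrightarrow> continuous_on UNIV f \<and>
     (\<exists>P. finite P \<and> \<Union>P = UNIV \<and> (\<forall>J\<in>P. \<exists>s\<in>\<int>. linear_piece f J s))"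

definition tropical_roots :: "(real \<Rightarrow> real) \<Rightarrow> real set" where
  "tropical_roots f = {x. \<not> f differentiable (at x)}"

definition tropical_increasing :: "(real \<Rightarrow> real) \<Rightarrow> bool" where
  "tropical_increasing f \<longleftrightarrow> tropical_rational f \<and> (\<forall>J s. linear_piece f J s \<longrightarrow> s > 0)"

definition tropical_decreasing :: "(real \<Rightarrow> real) \<Rightarrow> bool" where
  "tropical_decreasing f \<longleftrightarrow> tropical_rational f \<and> (\<forall>J s. linear_piece f J s \<longrightarrow> s < 0)"

definition tropical_monotone :: "(real \<Rightarrow> real) \<Rightarrow> bool" where
  "tropical_monotone f \<longleftrightarrow> tropical_increasing f \<or> tropical_decreasing f"

end

theory Submission
  imports Defs
begin

text \<open>
  Let \<open>P\<close> and \<open>Q\<close> be finite families of linear pieces covering the line for \<open>g\<close> and \<open>h\<close>.  On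
  each set \<open>J \<inter> h -` K\<close> with \<open>J \<in> Q\<close> and \<open>K \<in> P\<close> the composition is affine, with slope the
  product of the two slopes; since \<open>h\<close> is affine on \<open>J\<close>, this set is an interval.  These
  intervals cover the line, but some of them may be single points.  Two facts repair this.  By
  continuity, the closures of the nondegenerate ones already cover everything
  (\<open>tropical_rational_if_interval_cover\<close>).  And every linear piece of a function, being
  infinite, shares two points with some member of any given finite cover, so it has the slope of
  that member (\<open>slope_of_piece_in_cover\<close>); this determines the sign of all slopes of the
  composition.

  For the count of roots, the chain rule shows that a root of \<open>g \<circ> h\<close> is a root of \<open>h\<close> or is
  mapped by \<open>h\<close> to a root of \<open>g\<close>.  A monotone \<open>h\<close> is injective
  (\<open>inj_if_tropical_monotone\<close>), so each of the \<open>p\<close> roots of \<open>g\<close> has at most one preimage.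
  These counts are meaningful because the root sets are finite: a root is interior to no piece,
  and an interval has at most two points outside its interior.
\<close>

section \<open>Real intervals and finite sets\<close>

text \<open>A point of an interval which has further points of the interval on both sides is interior,
  so only a least and a greatest element can fail to be interior.\<close>

lemma finite_interval_minus_interior:
  fixes J :: "real set"
  assumes "is_interval J"
  shows "finite (J - interior J)"
proof -
  define L where "L = {x \<in> J. \<forall>y\<in>J. x \<le> y}"
  define U where "U = {x \<in> J. \<forall>y\<in>J. y \<le> x}"
  have "L \<subseteq> {a}" if "a \<in> L" for a
    using that unfolding L_def by (auto intro: antisym)
  moreover have "U \<subseteq> {a}" if "a \<in> U" for a
    using that unfolding U_def by (auto intro: antisym)
  ultimately have "finite (L \<union> U)"
    by (metis finite_Un finite.emptyI finite_insert finite_subset ex_in_conv)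
  moreover have "J - interior J \<subseteq> L \<union> U"
  proof
    fix x assume x: "x \<in> J - interior J"
    show "x \<in> L \<union> U"
    proof (rule ccontr)
      assume "x \<notin> L \<union> U"
      then obtain y z where yz: "y \<in> J" "z \<in> J" "y < x" "x < z"
        using x unfolding L_def U_def by (auto simp: not_le)
      have "{y<..<z} \<subseteq> J"
        using mem_is_interval_1_I[OF assms yz(1,2)] by (auto simp: less_imp_le)
      then have "x \<in> interior J"
        using yz(3,4) by (intro interiorI[of "{y<..<z}"]) auto
      with x show False by simp
    qed
  qed
  ultimately show ?thesis
    by (rule rev_finite_subset)
qed

lemma infinite_if_interior_nonempty:
  fixes J :: "real set"
  assumes "interior J \<noteq> {}"
  shows "infinite J"
  using assms finite_imp_not_open[OF finite_subset[OF interior_subset]] by blast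

section \<open>Slopes\<close>

lemma slope_unique:
  assumes "linear_with_slope f J s" "linear_with_slope f K t"
    and "x \<in> J \<inter> K" "y \<in> J \<inter> K" "x \<noteq> y"
  shows "s = t"
proof -
  obtain r u where "\<forall>x\<in>J. f x = s * x + r" "\<forall>x\<in>K. f x = t * x + u"
    using assms(1,2) unfolding linear_with_slope_def by auto
  then have "f x = s * x + r" "f x = t * x + u" "f y = s * y + r" "f y = t * y + u"
    using assms(3,4) by blast+
  then have "s * (x - y) = t * (x - y)"
    by (simp add: right_diff_distrib del: mult_cancel_right)
  with assms(5) show ?thesis by simp
qed

text \<open>By the pigeonhole principle the infinite piece meets some member of the finite cover in
  infinitely many points, and two of them determine the slope.\<close>

lemma slope_of_piece_in_cover:
  assumes "finite P" "\<Union>P = UNIV"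
    and cover: "\<And>K. K \<in> P \<Longrightarrow> \<exists>s\<in>S. linear_with_slope f K s"
    and piece: "linear_piece f J s"
  shows "s \<in> S"
proof -
  have "infinite J"
    using piece infinite_if_interior_nonempty unfolding linear_piece_def by blast
  moreover have "(\<Union>K\<in>P. J \<inter> K) = J"
    using assms(2) by (simp add: Int_Union[symmetric])
  ultimately have "infinite (\<Union>K\<in>P. J \<inter> K)"
    by simp
  then obtain K where K: "K \<in> P" "infinite (J \<inter> K)"
    using assms(1) by blast
  then obtain x where x: "x \<in> J \<inter> K"
    using infinite_imp_nonempty by blast
  have "infinite (J \<inter> K - {x})"
    using K(2) by simp
  then obtain y where "y \<in> J \<inter> K - {x}"
    using infinite_imp_nonempty by blast
  moreover obtain t where "t \<in> S" "linear_with_slope f K t"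
    using cover[OF K(1)] by auto
  ultimately show ?thesis
    using piece x slope_unique[of f J s K t x y] unfolding linear_piece_def by auto
qed

lemma linear_with_slope_closure:
  assumes "continuous_on UNIV f" "linear_with_slope f J s"
  shows "linear_with_slope f (closure J) s"
proof -
  obtain r where r: "\<forall>x\<in>J. f x = s * x + r"
    using assms(2) unfolding linear_with_slope_def by auto
  have "closed {x. f x = s * x + r}"
    by (intro closed_Collect_eq assms(1) continuous_intros)
  then have "closure J \<subseteq> {x. f x = s * x + r}"
    using r by (intro closure_minimal) auto
  then show ?thesis
    unfolding linear_with_slope_def by auto
qed

text \<open>Degenerate members of a cover can be dropped: together they form a finite set, so the
  others are dense, and by continuity they may be replaced by their closures.\<close>

lemma tropical_rational_if_interval_cover:
  assumes cont: "continuous_on UNIV f" and "finite P" "\<Union>P = UNIV"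
    and P: "\<And>J. J \<in> P \<Longrightarrow> is_interval J \<and> (\<exists>s\<in>\<int>. linear_with_slope f J s)"
  shows "tropical_rational f"
proof -
  define N where "N = {J \<in> P. interior J \<noteq> {}}"
  have finN: "finite N"
    using assms(2) unfolding N_def by simp
  have "finite J" if "J \<in> P - N" for J
    using that finite_interval_minus_interior[of J] P[of J] unfolding N_def by simp
  then have fin: "finite (\<Union>(P - N))"
    using assms(2) by blast
  have "closed (\<Union>(closure ` N))"
    using finN by (intro closed_Union) auto
  then have "open (- \<Union>(closure ` N))"
    by (simp add: open_closed)
  moreover have "- \<Union>(closure ` N) \<subseteq> \<Union>(P - N)"
  proof
    fix x assume x: "x \<in> - \<Union>(closure ` N)"
    obtain J where J: "J \<in> P" "x \<in> J"
      using assms(3) by blast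
    then have "J \<notin> N"
      using x closure_subset by blast
    with J show "x \<in> \<Union>(P - N)"
      by blast
  qed
  ultimately have "- \<Union>(closure ` N) = {}"
    using fin finite_imp_not_open finite_subset by metis
  then have "\<Union>(closure ` N) = UNIV"
    by auto
  moreover have "\<exists>s\<in>\<int>. linear_piece f (closure J) s" if J: "J \<in> N" for J
  proof -
    have "interior J \<noteq> {}" "is_interval J"
      using J P unfolding N_def by auto
    moreover have "interior J \<subseteq> interior (closure J)"
      by (simp add: closure_subset interior_mono)
    moreover have "is_interval (closure J)"
      using \<open>is_interval J\<close> by (simp add: is_interval_connected_1 connected_imp_connected_closure)
    ultimately show ?thesis
      using J P[of J] linear_with_slope_closure[OF cont]
      unfolding N_def linear_piece_def by blast
  qed
  ultimately show ?thesis
    unfolding tropical_rational_def using cont finN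
    by (intro conjI exI[of _ "closure ` N"]) auto
qed

section \<open>Differentiability and injectivity\<close>

lemma has_real_derivative_interior_piece:
  assumes "linear_with_slope f J s" "x \<in> interior J"
  shows "(f has_real_derivative s) (at x)"
proof -
  obtain r where r: "\<forall>x\<in>J. f x = s * x + r"
    using assms(1) unfolding linear_with_slope_def by auto
  have "((\<lambda>x. s * x + r) has_real_derivative s) (at x)"
    by (auto intro!: derivative_eq_intros)
  moreover have "s * y + r = f y" if "y \<in> interior J" for y
    using r that interior_subset[of J] by auto
  ultimately show ?thesis
    using has_field_derivative_transform_within_open[OF _ open_interior assms(2)] by blast
qed

lemma derivative_is_slope_off_finite:
  assumes "tropical_rational f"
  obtains F where "finite F"
    "\<And>x. x \<notin> F \<Longrightarrow> \<exists>J s. linear_piece f J s \<and> (f has_real_derivative s) (at x)"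
proof -
  obtain P where P: "finite P" "\<Union>P = UNIV" "\<forall>J\<in>P. \<exists>s\<in>\<int>. linear_piece f J s"
    using assms unfolding tropical_rational_def by auto
  show ?thesis
  proof (rule that)
    show "finite (\<Union>J\<in>P. J - interior J)"
      using P(1,3) finite_interval_minus_interior unfolding linear_piece_def by blast
  next
    fix x assume "x \<notin> (\<Union>J\<in>P. J - interior J)"
    then obtain J where "J \<in> P" "x \<in> interior J"
      using P(2) by blast
    then show "\<exists>J s. linear_piece f J s \<and> (f has_real_derivative s) (at x)"
      using P(3) has_real_derivative_interior_piece unfolding linear_piece_def by meson
  qed
qed

lemma finite_tropical_roots:
  assumes "tropical_rational f"
  shows "finite (tropical_roots f)"
proof -
  obtain F where "finite F"
    "\<And>x. x \<notin> F \<Longrightarrow> \<exists>J s. linear_piece f J s \<and> (f has_real_derivative s) (at x)"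
    using derivative_is_slope_off_finite[OF assms] by blast
  then show ?thesis
    unfolding tropical_roots_def
    by (elim rev_finite_subset) (use real_differentiable_def in blast)
qed

text \<open>Cutting the interval at an exceptional point leaves fewer exceptional points inside each
  half; with none left, the mean value theorem applies.\<close>

lemma strict_increasing_if_derivative_pos_off_finite:
  fixes f :: "real \<Rightarrow> real"
  assumes "finite F" "continuous_on UNIV f"
    and deriv: "\<And>x. x \<notin> F \<Longrightarrow> \<exists>s>0. (f has_real_derivative s) (at x)"
    and "a < b"
  shows "f a < f b"
  using assms(4)
proof (induction "card (F \<inter> {a<..<b})" arbitrary: a b rule: less_induct)
  case less
  show ?case
  proof (cases "F \<inter> {a<..<b} = {}")
    case True
    show ?thesis
    proof (rule DERIV_pos_imp_increasing_open[OF less.prems])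
      show "\<exists>y. (f has_real_derivative y) (at x) \<and> y > 0" if "a < x" "x < b" for x
      proof -
        have "x \<notin> F"
          using True that by auto
        then show ?thesis
          using deriv by blast
      qed
      show "continuous_on {a..b} f"
        using assms(2) continuous_on_subset by blast
    qed
  next
    case False
    then obtain c where c: "c \<in> F" "a < c" "c < b"
      by auto
    have "F \<inter> {a<..<c} \<subset> F \<inter> {a<..<b}" "F \<inter> {c<..<b} \<subset> F \<inter> {a<..<b}"
      using c by auto
    then have "card (F \<inter> {a<..<c}) < card (F \<inter> {a<..<b})"
      "card (F \<inter> {c<..<b}) < card (F \<inter> {a<..<b})"
      using assms(1) by (auto intro!: psubset_card_mono)
    then have "f a < f c" "f c < f b"
      using less.hyps c by auto
    then show ?thesis by simp
  qed
qed

lemma inj_if_tropical_monotone: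
  assumes "tropical_monotone f"
  shows "inj f"
proof -
  have rat: "tropical_rational f"
    using assms unfolding tropical_monotone_def tropical_increasing_def tropical_decreasing_def
    by auto
  then have cont: "continuous_on UNIV f"
    unfolding tropical_rational_def by auto
  obtain F where F: "finite F"
    "\<And>x. x \<notin> F \<Longrightarrow> \<exists>J s. linear_piece f J s \<and> (f has_real_derivative s) (at x)"
    using derivative_is_slope_off_finite[OF rat] by blast
  have "(\<forall>a b. a < b \<longrightarrow> f a < f b) \<or> (\<forall>a b. a < b \<longrightarrow> - f a < - f b)"
    using assms unfolding tropical_monotone_def
  proof
    assume "tropical_increasing f"
    then have "\<exists>s>0. (f has_real_derivative s) (at x)" if "x \<notin> F" for x
      using F(2)[OF that] unfolding tropical_increasing_def by blast
    then show ?thesis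
      using strict_increasing_if_derivative_pos_off_finite[OF F(1) cont] by blast
  next
    assume dec: "tropical_decreasing f"
    have "\<exists>s>0. ((\<lambda>x. - f x) has_real_derivative s) (at x)" if x: "x \<notin> F" for x
    proof -
      obtain s where "s < 0" "(f has_real_derivative s) (at x)"
        using F(2)[OF x] dec unfolding tropical_decreasing_def by blast
      then show ?thesis
        by (intro exI[of _ "- s"]) (auto intro: DERIV_minus)
    qed
    then show ?thesis
      using strict_increasing_if_derivative_pos_off_finite[OF F(1) continuous_on_minus[OF cont]]
      by blast
  qed
  then show ?thesis
    by (intro injI) (metis less_irrefl linorder_neqE)
qed

section \<open>Composition\<close>

lemma linear_with_slope_comp:
  assumes "linear_with_slope h J s" "linear_with_slope g K l" "h ` J \<subseteq> K"
  shows "linear_with_slope (g \<circ> h) J (s * l)"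
proof -
  obtain r u where "\<forall>x\<in>J. h x = s * x + r" "\<forall>y\<in>K. g y = l * y + u"
    using assms(1,2) unfolding linear_with_slope_def by auto
  then have "\<forall>x\<in>J. (g \<circ> h) x = (s * l) * x + (l * r + u)"
    using assms(3) by (auto simp: image_subset_iff algebra_simps)
  then show ?thesis
    unfolding linear_with_slope_def by blast
qed

lemma linear_with_slope_between:
  assumes "linear_with_slope h J s" "a \<in> J" "x \<in> J" "b \<in> J" "a \<le> x" "x \<le> b"
  shows "s \<ge> 0 \<Longrightarrow> h a \<le> h x \<and> h x \<le> h b" "s \<le> 0 \<Longrightarrow> h b \<le> h x \<and> h x \<le> h a"
proof -
  obtain r where "\<forall>x\<in>J. h x = s * x + r"
    using assms(1) unfolding linear_with_slope_def by auto
  then have h: "h a = s * a + r" "h x = s * x + r" "h b = s * b + r"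
    using assms(2-4) by blast+
  show "h a \<le> h x \<and> h x \<le> h b" if "s \<ge> 0"
    unfolding h using assms(5,6) that by (simp add: mult_left_mono)
  show "h b \<le> h x \<and> h x \<le> h a" if "s \<le> 0"
    unfolding h using assms(5,6) that by (simp add: mult_left_mono_neg)
qed

lemma is_interval_linear_vimage:
  assumes "is_interval J" "linear_with_slope h J s" "is_interval K"
  shows "is_interval (J \<inter> h -` K)"
  unfolding is_interval_1
proof (intro ballI allI impI, elim conjE)
  fix a b x assume ab: "a \<in> J \<inter> h -` K" "b \<in> J \<inter> h -` K" "a \<le> x" "x \<le> b"
  then have x: "x \<in> J"
    using mem_is_interval_1_I[OF assms(1)] by blast
  then have "h a \<le> h x \<and> h x \<le> h b \<or> h b \<le> h x \<and> h x \<le> h a"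
    using linear_with_slope_between[OF assms(2), of a x b] ab
    by (cases "s \<ge> 0") auto
  then have "h x \<in> K"
    using ab mem_is_interval_1_I[OF assms(3)] by blast
  with x show "x \<in> J \<inter> h -` K"
    by simp
qed

lemma tropical_rational_comp:
  assumes "tropical_rational g" "tropical_rational h"
  shows "tropical_rational (g \<circ> h)"
    and "linear_piece (g \<circ> h) J s \<Longrightarrow>
      \<exists>A u B v. linear_piece h A u \<and> linear_piece g B v \<and> s = u * v"
proof -
  obtain P where P: "finite P" "\<Union>P = UNIV" "\<forall>J\<in>P. \<exists>s\<in>\<int>. linear_piece g J s"
    using assms(1) unfolding tropical_rational_def by auto
  obtain Q where Q: "finite Q" "\<Union>Q = UNIV" "\<forall>J\<in>Q. \<exists>s\<in>\<int>. linear_piece h J s"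
    using assms(2) unfolding tropical_rational_def by auto
  define R where "R = {A \<inter> h -` B | A B. A \<in> Q \<and> B \<in> P}"
  define S where "S = {u * v | u v. \<exists>A B. linear_piece h A u \<and> linear_piece g B v}"
  have finR: "finite R"
    unfolding R_def using P(1) Q(1) by (intro finite_image_set2) simp_all
  have "x \<in> \<Union>R" for x
  proof -
    have "x \<in> \<Union>Q" "h x \<in> \<Union>P"
      using P(2) Q(2) by simp_all
    then obtain A B where "A \<in> Q" "x \<in> A" "B \<in> P" "h x \<in> B"
      by (elim UnionE)
    then show ?thesis
      unfolding R_def by (intro UnionI[of "A \<inter> h -` B"]) auto
  qed
  then have UR: "\<Union>R = UNIV"
    by (intro UNIV_eq_I[symmetric])
  have pieces: "is_interval I \<and> (\<exists>s\<in>\<int> \<inter> S. linear_with_slope (g \<circ> h) I s)"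
    if IR: "I \<in> R" for I
  proof -
    obtain A B where I: "I = A \<inter> h -` B" "A \<in> Q" "B \<in> P"
      using IR unfolding R_def by blast
    obtain u where u: "u \<in> \<int>" "linear_piece h A u"
      using Q(3) I(2) by (elim ballE bexE) auto
    obtain v where v: "v \<in> \<int>" "linear_piece g B v"
      using P(3) I(3) by (elim ballE bexE) auto
    have "linear_with_slope h I u"
      using u(2) unfolding I(1) linear_piece_def linear_with_slope_def by auto
    moreover have "linear_with_slope g B v" "h ` I \<subseteq> B"
      using v(2) unfolding I(1) linear_piece_def by auto
    ultimately have "linear_with_slope (g \<circ> h) I (u * v)"
      by (rule linear_with_slope_comp)
    moreover have "is_interval I"
      using u(2) v(2) unfolding I(1) linear_piece_def
      by (intro is_interval_linear_vimage) auto
    moreover have "u * v \<in> \<int> \<inter> S"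
      using u v unfolding S_def by auto
    ultimately show ?thesis
      by blast
  qed
  have "continuous_on UNIV g" "continuous_on UNIV h"
    using assms unfolding tropical_rational_def by auto
  then have "continuous_on UNIV (g \<circ> h)"
    by (metis continuous_on_compose continuous_on_subset subset_UNIV)
  then show "tropical_rational (g \<circ> h)"
    by (rule tropical_rational_if_interval_cover[OF _ finR UR]) (use pieces in blast)
  show "\<exists>A u B v. linear_piece h A u \<and> linear_piece g B v \<and> s = u * v"
    if "linear_piece (g \<circ> h) J s"
  proof -
    have "s \<in> S"
      by (rule slope_of_piece_in_cover[OF finR UR _ that]) (use pieces in blast)
    then show ?thesis
      unfolding S_def by blast
  qed
qed

lemma tropical_monotone_comp:
  assumes "tropical_monotone g" "tropical_monotone h"
  shows "tropical_monotone (g \<circ> h)"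
proof -
  have "tropical_rational g" "tropical_rational h"
    using assms unfolding tropical_monotone_def tropical_increasing_def tropical_decreasing_def
    by auto
  note comp = tropical_rational_comp[OF this]
  have "(\<forall>A u. linear_piece h A u \<longrightarrow> u > 0) \<or> (\<forall>A u. linear_piece h A u \<longrightarrow> u < 0)"
    "(\<forall>B v. linear_piece g B v \<longrightarrow> v > 0) \<or> (\<forall>B v. linear_piece g B v \<longrightarrow> v < 0)"
    using assms
    unfolding tropical_monotone_def tropical_increasing_def tropical_decreasing_def by blast+
  then have "(\<forall>A u B v. linear_piece h A u \<longrightarrow> linear_piece g B v \<longrightarrow> u * v > 0) \<or>
      (\<forall>A u B v. linear_piece h A u \<longrightarrow> linear_piece g B v \<longrightarrow> u * v < 0)"
    by (elim disjE) (meson mult_pos_pos mult_neg_neg mult_pos_neg mult_neg_pos)+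
  then have "(\<forall>J s. linear_piece (g \<circ> h) J s \<longrightarrow> s > 0) \<or>
      (\<forall>J s. linear_piece (g \<circ> h) J s \<longrightarrow> s < 0)"
    using comp(2) by (elim disjE) blast+
  then show ?thesis
    using comp(1)
    unfolding tropical_monotone_def tropical_increasing_def tropical_decreasing_def by blast
qed

lemma tropical_roots_comp_subset:
  "tropical_roots (g \<circ> h) \<subseteq> tropical_roots h \<union> h -` tropical_roots g"
  unfolding tropical_roots_def using differentiable_chain_at[of h _ g] by blast

theorem proposition1p1:
  fixes g h :: "real \<Rightarrow> real" and p q :: nat
  assumes "tropical_monotone g" and "tropical_monotone h"
    and "card (tropical_roots g) = p" and "card (tropical_roots h) = q"
  shows "tropical_monotone (g \<circ> h) \<and>
    finite (tropical_roots (g \<circ> h)) \<and> card (tropical_roots (g \<circ> h)) \<le> p + q \<and>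
    (\<forall>a b s l :: real. a \<le> b \<and> linear_with_slope h {a..b} s \<and>
       ((tropical_increasing h \<and> linear_with_slope g {h a..h b} l) \<or>
        (tropical_decreasing h \<and> linear_with_slope g {h b..h a} l)) \<longrightarrow>
       linear_with_slope (g \<circ> h) {a..b} (s * l))"
proof (intro conjI allI impI)
  show mono: "tropical_monotone (g \<circ> h)"
    using assms(1,2) by (rule tropical_monotone_comp)
  have fin: "finite (tropical_roots f)" if "tropical_monotone f" for f
    using that finite_tropical_roots
    unfolding tropical_monotone_def tropical_increasing_def tropical_decreasing_def by blast
  show "finite (tropical_roots (g \<circ> h))"
    using mono by (rule fin)
  have inj: "inj h"
    using assms(2) by (rule inj_if_tropical_monotone)
  have "card (tropical_roots (g \<circ> h)) \<le> card (tropical_roots h \<union> h -` tropical_roots g)"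
    using fin assms(1,2) inj
    by (intro card_mono tropical_roots_comp_subset) (auto intro: finite_vimageI)
  also have "\<dots> \<le> card (tropical_roots h) + card (h -` tropical_roots g)"
    by (rule card_Un_le)
  also have "card (h -` tropical_roots g) \<le> card (tropical_roots g)"
    using card_vimage_inj_on_le[OF inj fin[OF assms(1)]] by simp
  finally show "card (tropical_roots (g \<circ> h)) \<le> p + q"
    using assms(3,4) by simp
next
  fix a b s l
  assume asm: "a \<le> b \<and> linear_with_slope h {a..b} s \<and>
    ((tropical_increasing h \<and> linear_with_slope g {h a..h b} l) \<or>
     (tropical_decreasing h \<and> linear_with_slope g {h b..h a} l))"
  then have lin: "linear_with_slope h {a..b} s"
    by simp
  show "linear_with_slope (g \<circ> h) {a..b} (s * l)"
  proof (cases "a = b")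
    case True
    \<comment> \<open>A one-point interval is no linear piece, so the sign of \<open>s\<close> is unknown here; but on a
      single point every slope is possible.\<close>
    then show ?thesis
      unfolding linear_with_slope_def by (auto intro: exI[of _ "(g \<circ> h) a - s * l * a"])
  next
    case False
    then have "linear_piece h {a..b} s"
      using asm unfolding linear_piece_def by auto
    then have sign: "tropical_increasing h \<Longrightarrow> s > 0" "tropical_decreasing h \<Longrightarrow> s < 0"
      unfolding tropical_increasing_def tropical_decreasing_def by blast+
    have between: "s \<ge> 0 \<Longrightarrow> h ` {a..b} \<subseteq> {h a..h b}" "s \<le> 0 \<Longrightarrow> h ` {a..b} \<subseteq> {h b..h a}"
      using linear_with_slope_between[OF lin, of a _ b] asm by auto
    from asm consider "tropical_increasing h" "linear_with_slope g {h a..h b} l"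
      | "tropical_decreasing h" "linear_with_slope g {h b..h a} l"
      by blast
    then show ?thesis
      using linear_with_slope_comp[OF lin] sign between by cases auto
  qed
qed

end
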